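(* For each positive integer $m$, $C_{\infty,\ldots,\infty}\le (8/5)^{\frac{m-1}{2}}$, where $C_{\infty,\ldots,\infty}:=\sup_{n\in\mathbb{N}} C_{\infty,\ldots,\infty,n,\ldots,n}$ (with $m$ copies of $n$).
   Context: Let $\mathbb{K}\in\{\mathbb{R},\mathbb{C}\}$ and $\ell_\infty^n=\mathbb{K}^n$ with the sup norm. For positive integers $n_1,\ldots,n_m$, $C_{\infty,\ldots,\infty,n_1,\ldots,n_m}$ is the smallest constant $C\ge0$ for which there is an $m$-linear form $A\colon\ell_\infty^{n_1}\times\cdots\times\ell_\infty^{n_m}\to\mathbb{K}$ of the type $A(x^{(1)},\ldots,x^{(m)})=\sum_{i_1=1}^{n_1}\cdots\sum_{i_m=1}^{n_m}a_{i_1\cdots i_m}x^{(1)}_{i_1}\cdots x^{(m)}_{i_m}$ with all $a_{i_1\cdots i_m}\in\{-1,1\}$ such that $\|A\|\le C\max\{n_1^{1/2},\ldots,n_m^{1/2}\}\prod_{k=1}^m n_k^{1/2}$, where $\|A\|=\sup\{|A(x^{(1)},\ldots,x^{(m)})|:\|x^{(k)}\|_\infty\le1\ \forall k\}$. *)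

theory Defs
  imports "HOL-Analysis.Analysis" "HOL-Library.FuncSet"
begin

text \<open>
  The scalar field is a type variable; the statements instantiate it with \<^typ>\<open>real\<close> and
  \<^typ>\<open>complex\<close>. Factors are numbered \<open>1..m\<close>, the \<open>k\<close>-th one being \<open>\<ell>\<^sub>\<infinity>\<close> of dimension \<open>n k\<close>,
  with coordinates numbered \<open>1..n k\<close>. A tuple of vectors is \<open>x\<close> with \<open>x k j\<close> the \<open>j\<close>-th
  coordinate of the \<open>k\<close>-th vector; values of \<open>n\<close>, \<open>x\<close> and the coefficients outside these ranges
  are never used.
\<close>

definition linf_norm :: "nat \<Rightarrow> (nat \<Rightarrow> 'a::real_normed_field) \<Rightarrow> real" where
  "linf_norm N v = Max ((\<lambda>j. norm (v j)) ` {1..N})"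

definition multi_indices :: "nat \<Rightarrow> (nat \<Rightarrow> nat) \<Rightarrow> (nat \<Rightarrow> nat) set" where
  "multi_indices m n = (\<Pi>\<^sub>E k\<in>{1..m}. {1..n k})"

definition mform ::
  "nat \<Rightarrow> (nat \<Rightarrow> nat) \<Rightarrow> ((nat \<Rightarrow> nat) \<Rightarrow> 'a::real_normed_field) \<Rightarrow> (nat \<Rightarrow> nat \<Rightarrow> 'a) \<Rightarrow> 'a" where
  "mform m n a x = (\<Sum>i\<in>multi_indices m n. a i * (\<Prod>k=1..m. x k (i k)))"

definition mform_norm ::
  "nat \<Rightarrow> (nat \<Rightarrow> nat) \<Rightarrow> ((nat \<Rightarrow> nat) \<Rightarrow> 'a::real_normed_field) \<Rightarrow> real" where
  "mform_norm m n a =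
     (SUP x\<in>{x. \<forall>k\<in>{1..m}. linf_norm (n k) (x k) \<le> 1}. norm (mform m n a x))"

definition admissible ::
  "'a::real_normed_field itself \<Rightarrow> nat \<Rightarrow> (nat \<Rightarrow> nat) \<Rightarrow> real \<Rightarrow> bool" where
  "admissible _ m n C \<longleftrightarrow> 0 \<le> C \<and>
     (\<exists>a :: (nat \<Rightarrow> nat) \<Rightarrow> 'a. (\<forall>i\<in>multi_indices m n. a i \<in> {-1, 1}) \<and>
        mform_norm m n a \<le>
          C * Max ((\<lambda>k. sqrt (real (n k))) ` {1..m}) * (\<Prod>k=1..m. sqrt (real (n k))))"

definition KSZ_const :: "'a::real_normed_field itself \<Rightarrow> nat \<Rightarrow> (nat \<Rightarrow> nat) \<Rightarrow> real" where
  "KSZ_const K m n = (LEAST C. admissible K m n C)"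

text \<open>The supremum is taken in \<^typ>\<open>ereal\<close>, so that an upper bound for it also asserts that the
  constants are bounded.\<close>

definition KSZ_sup :: "'a::real_normed_field itself \<Rightarrow> nat \<Rightarrow> ereal" where
  "KSZ_sup K m = (SUP n\<in>{1..}. ereal (KSZ_const K m (\<lambda>_. n)))"

lemma finite_multi_indices: "finite (multi_indices m n)"
  by (simp add: multi_indices_def finite_PiE)

lemma mform_norm_cong:
  assumes "\<And>i. i \<in> multi_indices m n \<Longrightarrow> a i = b i"
  shows "mform_norm m n a = mform_norm m n b"
proof -
  have "mform m n a x = mform m n b x" for x
    unfolding mform_def using assms by (intro sum.cong) auto
  then show ?thesis by (simp add: mform_norm_def)
qed

text \<open>The supremum defining \<open>mform_norm\<close> is over a bounded set.\<close>

lemma bdd_above_mform: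
  "bdd_above ((\<lambda>x. norm (mform m n a x)) ` {x. \<forall>k\<in>{1..m}. linf_norm (n k) (x k) \<le> 1})"
proof (rule bdd_aboveI2)
  fix x :: "nat \<Rightarrow> nat \<Rightarrow> 'a"
  assume x: "x \<in> {x. \<forall>k\<in>{1..m}. linf_norm (n k) (x k) \<le> 1}"
  have le1: "norm (x k j) \<le> 1" if "k \<in> {1..m}" "j \<in> {1..n k}" for k j
  proof -
    have "norm (x k j) \<le> linf_norm (n k) (x k)"
      unfolding linf_norm_def using that(2) by (intro Max_ge) auto
    then show ?thesis using x that(1) by fastforce
  qed
  have "norm (a i * (\<Prod>k=1..m. x k (i k))) \<le> norm (a i)" if "i \<in> multi_indices m n" for i
  proof -
    have "(\<Prod>k=1..m. norm (x k (i k))) \<le> 1"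
      using that by (intro prod_le_1 conjI le1 norm_ge_zero) (auto simp: multi_indices_def dest: PiE_mem)
    then show ?thesis by (simp add: norm_mult prod_norm[symmetric] mult_left_le)
  qed
  then show "norm (mform m n a x) \<le> (\<Sum>i\<in>multi_indices m n. norm (a i))"
    unfolding mform_def by (intro sum_norm_le) auto
qed

text \<open>The smallest admissible constant exists, so the \<open>LEAST\<close> above is meaningful.\<close>

lemma admissible_least:
  fixes K :: "'a::real_normed_field itself"
  assumes "1 \<le> m" and pos: "\<And>k. k \<in> {1..m} \<Longrightarrow> 1 \<le> n k"
  shows "\<exists>C. admissible K m n C \<and> (\<forall>C'. admissible K m n C' \<longrightarrow> C \<le> C')"
proof -
  let ?I = "multi_indices m n"
  define D where "D = Max ((\<lambda>k. sqrt (real (n k))) ` {1..m}) * (\<Prod>k=1..m. sqrt (real (n k)))"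
  define S where "S = (\<lambda>a :: (nat \<Rightarrow> nat) \<Rightarrow> 'a. mform_norm m n a) ` (\<Pi>\<^sub>E i\<in>?I. {-1, 1})"
  have "finite S" unfolding S_def by (intro finite_imageI finite_PiE finite_multi_indices) auto
  have "S \<noteq> {}" by (auto simp: S_def PiE_eq_empty_iff)
  have "0 < Max ((\<lambda>k. sqrt (real (n k))) ` {1..m})"
    using assms(1) pos[of 1] by (subst Max_gr_iff) (auto intro!: bexI[of _ 1])
  moreover have "0 < (\<Prod>k=1..m. sqrt (real (n k)))"
    using pos by (intro prod_pos) fastforce
  ultimately have "0 < D" by (simp add: D_def)
  have adm: "admissible K m n C \<longleftrightarrow> 0 \<le> C \<and> Min S \<le> C * D" for C
  proof -
    have "(\<exists>a :: (nat \<Rightarrow> nat) \<Rightarrow> 'a. (\<forall>i\<in>?I. a i \<in> {-1, 1}) \<and> mform_norm m n a \<le> C * D)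
        \<longleftrightarrow> (\<exists>s\<in>S. s \<le> C * D)" (is "?L \<longleftrightarrow> ?R")
    proof
      assume ?L
      then obtain a :: "(nat \<Rightarrow> nat) \<Rightarrow> 'a"
        where a: "\<forall>i\<in>?I. a i \<in> {-1, 1}" "mform_norm m n a \<le> C * D" by blast
      have "mform_norm m n (restrict a ?I) = mform_norm m n a"
        by (intro mform_norm_cong) auto
      moreover have "restrict a ?I \<in> (\<Pi>\<^sub>E i\<in>?I. {-1, 1})" using a(1) by auto
      ultimately show ?R using a(2) unfolding S_def by (metis image_eqI)
    next
      assume ?R
      then show ?L unfolding S_def by (auto dest: PiE_mem)
    qed
    also have "\<dots> \<longleftrightarrow> Min S \<le> C * D"
      using \<open>finite S\<close> \<open>S \<noteq> {}\<close> by (simp add: Min_le_iff)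
    finally show ?thesis by (simp add: admissible_def D_def mult.assoc)
  qed
  show ?thesis
  proof (intro exI[of _ "max 0 (Min S / D)"] conjI allI impI)
    have "Min S / D \<le> max 0 (Min S / D)" by simp
    then have "Min S \<le> max 0 (Min S / D) * D"
      by (simp only: pos_divide_le_eq[OF \<open>0 < D\<close>])
    then show "admissible K m n (max 0 (Min S / D))"
      by (simp only: adm) simp
    fix C' assume "admissible K m n C'"
    then show "max 0 (Min S / D) \<le> C'"
      using \<open>0 < D\<close> by (simp add: adm pos_divide_le_eq)
  qed
qed

end

theory Submission imports Defs begin

text \<open>
  A submatrix \<open>h\<close> of size \<open>n\<close> of a Hadamard matrix of order \<open>N\<close> has operator norm at most \<open>\<surd>N\<close>
  on \<open>\<ell>\<^sub>2\<close>. The form with coefficients \<open>\<Prod>\<^sub>k h (i\<^sub>k\<^sub>+\<^sub>1) (i\<^sub>k)\<close> is the sum of the entries of the vector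
  \<open>D\<^sub>m h D\<^sub>m\<^sub>-\<^sub>1 h \<dots> h x\<^sub>1\<close>, where \<open>D\<^sub>k\<close> is the diagonal matrix of \<open>x\<^sub>k\<close>, a contraction; so its norm is
  at most \<open>n N\<^bsup>(m-1)/2\<^esup>\<close>. The orders \<open>2\<^sup>k\<close> and \<open>12 \<cdot> 2\<^sup>k\<close> are dense enough to choose \<open>n \<le> N \<le> 8n/5\<close>
  for every \<open>n\<close>; the ratio \<open>8/5\<close> is attained at \<open>n = 5\<close>.
\<close>

section \<open>Hadamard matrices of orders \<open>2 ^ k\<close> and
  \<open>12 * 2 ^ k\<close>\<close>

definition hadamard :: "nat \<Rightarrow> (nat \<Rightarrow> nat \<Rightarrow> int) \<Rightarrow> bool" where
  "hadamard N h \<longleftrightarrow> (\<forall>i<N. \<forall>j<N. h i j \<in> {-1, 1}) \<and>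
     (\<forall>i<N. \<forall>j<N. i \<noteq> j \<longrightarrow> (\<Sum>k<N. h k i * h k j) = 0)"

lemma sum_lessThan_double:
  fixes f :: "nat \<Rightarrow> 'a::comm_monoid_add"
  shows "(\<Sum>k<2 * N. f k) = (\<Sum>k<N. f (2 * k) + f (2 * k + 1))"
  by (induction N) (simp_all add: add.assoc)

text \<open>Sylvester doubling: the Kronecker product of \<open>h\<close> with the 2 x 2 matrix with
  rows (1, 1) and (1, -1). The quotient by 2 indexes \<open>h\<close>, the parity indexes the small
  factor.\<close>

lemma hadamard_double:
  assumes "hadamard N h"
  shows "hadamard (2 * N)
    (\<lambda>i j. h (i div 2) (j div 2) * (if odd i \<and> odd j then -1 else 1))" (is "hadamard _ ?g")
  unfolding hadamard_def
proof (intro conjI allI impI)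
  fix i j assume ij: "i < 2 * N" "j < 2 * N"
  then have lt: "i div 2 < N" "j div 2 < N" by auto
  then show "?g i j \<in> {-1, 1}" using assms by (auto simp: hadamard_def)
  assume "i \<noteq> j"
  \<comment> \<open>\<open>1 + s\<close> is the inner product of the columns \<open>i mod 2\<close>
    and \<open>j mod 2\<close> of the 2 x 2 factor; it vanishes when the parities differ.\<close>
  define s :: int where "s = (if odd i then -1 else 1) * (if odd j then -1 else 1)"
  have "(\<Sum>k<2 * N. ?g k i * ?g k j) = (\<Sum>k<N. h k (i div 2) * h k (j div 2) * (1 + s))"
    unfolding sum_lessThan_double by (intro sum.cong) (auto simp: s_def)
  also have "\<dots> = (\<Sum>k<N. h k (i div 2) * h k (j div 2)) * (1 + s)"
    by (simp add: sum_distrib_right)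
  also have "\<dots> = 0"
  proof (cases "i div 2 = j div 2")
    case True
    then have "odd i \<longleftrightarrow> even j"
      using \<open>i \<noteq> j\<close> by (metis even_two_times_div_two odd_two_times_div_two_succ)
    then show ?thesis by (simp add: s_def)
  next
    case False
    then show ?thesis using assms lt by (simp add: hadamard_def)
  qed
  finally show "(\<Sum>k<2 * N. ?g k i * ?g k j) = 0" .
qed

lemma hadamard_mult_power2:
  assumes "\<exists>h. hadamard N h"
  shows "\<exists>h. hadamard (N * 2 ^ k) h"
proof (induction k)
  case (Suc k)
  then obtain h where "hadamard (N * 2 ^ k) h" by blast
  then have "\<exists>h. hadamard (2 * (N * 2 ^ k)) h" by (intro exI, rule hadamard_double)
  then show ?case by (simp add: mult.left_commute)
qed (use assms in simp)

lemma hadamard_1: "hadamard 1 (\<lambda>_ _. 1)"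
  by (simp add: hadamard_def)

text \<open>Paley's construction; \<open>1, 3, 4, 5, 9\<close> are the nonzero squares modulo \<open>11\<close>.\<close>

definition paley12 :: "nat \<Rightarrow> nat \<Rightarrow> int" where
  "paley12 i j = (if i = 0 \<or> j \<noteq> 0 \<and> (i + 11 - j) mod 11 \<in> {0, 1, 3, 4, 5, 9} then 1 else -1)"

lemma hadamard_12: "hadamard 12 paley12"
proof -
  have lt: "{..<12::nat} = {0, 1, 2, 3, 4, 5, 6, 7, 8, 9, 10, 11}"
    by (simp add: lessThan_nat_numeral lessThan_Suc insert_commute)
  have sum: "(\<Sum>k<12. f k)
      = f 0 + f 1 + f 2 + f 3 + f 4 + f 5 + f 6 + f 7 + f 8 + f 9 + f 10 + f 11" for f :: "nat \<Rightarrow> int"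
    unfolding lt by simp
  have all: "(\<forall>i<12. P i) \<longleftrightarrow> (\<forall>i\<in>{0, 1, 2, 3, 4, 5, 6, 7, 8, 9, 10, 11}. P i)" for P :: "nat \<Rightarrow> bool"
    unfolding lt[symmetric] by auto
  have "\<forall>i<12. \<forall>j<12. i \<noteq> j \<longrightarrow> (\<Sum>k<12. paley12 k i * paley12 k j) = 0"
    unfolding sum all ball_simps by (simp add: paley12_def)
  moreover have "paley12 i j \<in> {-1, 1}" for i j
    by (simp add: paley12_def)
  ultimately show ?thesis unfolding hadamard_def by blast
qed

lemma hadamard_order_between:
  assumes "1 \<le> n"
  obtains N h where "hadamard N h" "n \<le> N" "5 * N \<le> 8 * n"
proof (cases "n = 1")
  case True
  then show ?thesis using that[OF hadamard_1] by simp
next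
  case False
  then obtain k where k: "2 ^ k < n" "n \<le> 2 ^ (k + 1)"
    using ex_power_ivl2[of 2 n] assms by auto
  obtain g where g: "hadamard (2 ^ (k + 1)) g"
    using hadamard_mult_power2[of 1 "k + 1"] hadamard_1 by auto
  show ?thesis
  proof (cases "k < 3")
    case True
    \<comment> \<open>Here \<open>N = 2 ^ (k + 1)\<close> suffices because \<open>n\<close> is an
      integer above \<open>2 ^ k\<close>: the worst cases are 2/2, 4/3 and 8/5.\<close>
    then have "k = 0 \<or> k = 1 \<or> k = 2" by auto
    then show ?thesis using k by (intro that[OF g]) auto
  next
    case False
    then obtain l where l: "k = l + 3" using le_Suc_ex[of 3 k] by (auto simp: add.commute)
    obtain h where h: "hadamard (12 * 2 ^ l) h"
      using hadamard_mult_power2[of 12 l] hadamard_12 by auto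
    have n: "8 * 2 ^ l < n" "n \<le> 16 * 2 ^ l" using k by (auto simp: l power_add)
    show ?thesis
    \<comment> \<open>Splitting the dyadic interval at its midpoint keeps \<open>N / n\<close> below
      12/8 in the lower half and below 16/12 in the upper half, both under 8/5.\<close>
    proof (cases "n \<le> 12 * 2 ^ l")
      case True
      then show ?thesis using n by (intro that[OF h]) auto
    next
      case False
      then show ?thesis using n by (intro that[OF g]) (auto simp: l power_add)
    qed
  qed
qed

section \<open>Action of Hadamard matrices and their corners on the Euclidean norm\<close>

lemma hadamard_sum_norm_squared:
  fixes x :: "nat \<Rightarrow> 'a::real_inner"
  assumes "hadamard N h"
  shows "(\<Sum>i<N. (norm (\<Sum>j<N. real_of_int (h i j) *\<^sub>R x j))\<^sup>2) = N * (\<Sum>j<N. (norm (x j))\<^sup>2)"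
proof -
  \<comment> \<open>This is \<open>h\<close>^T \<open>h\<close> = \<open>N\<close> I. Once the
    squares are expanded and the row sum is moved innermost, only the diagonal terms
    survive.\<close>
  have orth: "(\<Sum>k<N. real_of_int (h k i * h k j)) = (if i = j then N else 0)"
    if "i < N" "j < N" for i j
  proof (cases "i = j")
    case True
    have "h k i * h k i = 1" if "k < N" for k
      using assms that \<open>i < N\<close> unfolding hadamard_def by fastforce
    then show ?thesis using True by simp
  next
    case False
    then have "(\<Sum>k<N. h k i * h k j) = 0" using assms that unfolding hadamard_def by blast
    then show ?thesis using False by (simp only: of_int_sum[symmetric]) simp
  qed
  have "(\<Sum>i<N. (norm (\<Sum>j<N. real_of_int (h i j) *\<^sub>R x j))\<^sup>2)
      = (\<Sum>k<N. \<Sum>i<N. \<Sum>j<N. real_of_int (h k i * h k j) * (x i \<bullet> x j))"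
    unfolding power2_norm_eq_inner inner_sum_left unfolding inner_sum_right
    by (simp add: mult.assoc mult.left_commute)
  also have "\<dots> = (\<Sum>i<N. \<Sum>k<N. \<Sum>j<N. real_of_int (h k i * h k j) * (x i \<bullet> x j))"
    by (rule sum.swap)
  also have "\<dots> = (\<Sum>i<N. \<Sum>j<N. \<Sum>k<N. real_of_int (h k i * h k j) * (x i \<bullet> x j))"
    by (rule sum.cong[OF refl], rule sum.swap)
  also have "\<dots> = (\<Sum>i<N. \<Sum>j<N. (if i = j then N else 0) * (x i \<bullet> x j))"
    by (intro sum.cong refl, subst sum_distrib_right[symmetric], subst orth) auto
  also have "\<dots> = (\<Sum>i<N. N * (norm (x i))\<^sup>2)"
    by (intro sum.cong refl) (simp add: if_distrib[of "\<lambda>c. real c * _"] power2_norm_eq_inner cong: if_cong)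
  finally show ?thesis by (simp add: sum_distrib_left)
qed

text \<open>Take the upper left \<open>n\<close> x \<open>n\<close> corner of a Hadamard matrix of
  order \<open>N\<close>. Padding \<open>x\<close> with zeros leaves its norm unchanged, and
  dropping the rows from \<open>n\<close> on only decreases the left side, so the factor
  \<open>N\<close>, at most \<open>8 / 5 * n\<close>, remains valid.\<close>

lemma exists_sign_matrix:
  assumes "1 \<le> n"
  shows "\<exists>h :: nat \<Rightarrow> nat \<Rightarrow> real. (\<forall>i\<in>{1..n}. \<forall>j\<in>{1..n}. h i j \<in> {-1, 1}) \<and>
    (\<forall>x :: nat \<Rightarrow> 'a::real_inner.
      (\<Sum>i=1..n. (norm (\<Sum>j=1..n. h i j *\<^sub>R x j))\<^sup>2) \<le> 8 / 5 * n * (\<Sum>j=1..n. (norm (x j))\<^sup>2))"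
proof -
  obtain N g where g: "hadamard N g" and N: "n \<le> N" "5 * N \<le> 8 * n"
    using hadamard_order_between[OF assms] .
  have shift: "(\<Sum>j=1..n. f j) = (\<Sum>j<n. f (Suc j))" for f :: "nat \<Rightarrow> 'b::comm_monoid_add"
    by (simp add: sum.atLeast1_atMost_eq)
  show ?thesis
  proof (intro exI[of _ "\<lambda>i j. real_of_int (g (i - 1) (j - 1))"] conjI ballI allI)
    show "real_of_int (g (i - 1) (j - 1)) \<in> {-1, 1}" if "i \<in> {1..n}" "j \<in> {1..n}" for i j
    proof -
      have "i - 1 < N" "j - 1 < N" using that N by auto
      then have "g (i - 1) (j - 1) \<in> {-1, 1}" using g unfolding hadamard_def by blast
      then show ?thesis by auto
    qed
    fix x :: "nat \<Rightarrow> 'a"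
    define y where "y j = (if j < n then x (Suc j) else 0)" for j
    have y: "(\<Sum>j<N. f j (y j)) = (\<Sum>j<n. f j (x (Suc j)))" if "\<And>j. f j 0 = 0"
      for f :: "nat \<Rightarrow> 'a \<Rightarrow> 'b::comm_monoid_add"
      using N that by (intro sum.mono_neutral_cong_right) (auto simp: y_def)
    have "(\<Sum>i=1..n. (norm (\<Sum>j=1..n. real_of_int (g (i - 1) (j - 1)) *\<^sub>R x j))\<^sup>2)
        = (\<Sum>i<n. (norm (\<Sum>j<N. real_of_int (g i j) *\<^sub>R y j))\<^sup>2)"
      unfolding shift by (subst y) simp_all
    also have "\<dots> \<le> (\<Sum>i<N. (norm (\<Sum>j<N. real_of_int (g i j) *\<^sub>R y j))\<^sup>2)"
      using N by (intro sum_mono2) auto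
    also have "\<dots> = N * (\<Sum>j<N. (norm (y j))\<^sup>2)"
      by (rule hadamard_sum_norm_squared[OF g])
    also have "\<dots> = N * (\<Sum>j=1..n. (norm (x j))\<^sup>2)"
      unfolding shift by (subst y) simp_all
    also have "\<dots> \<le> 8 / 5 * n * (\<Sum>j=1..n. (norm (x j))\<^sup>2)"
      using N by (intro mult_right_mono sum_nonneg) auto
    finally show "(\<Sum>i=1..n. (norm (\<Sum>j=1..n. real_of_int (g (i - 1) (j - 1)) *\<^sub>R x j))\<^sup>2)
        \<le> 8 / 5 * n * (\<Sum>j=1..n. (norm (x j))\<^sup>2)" .
  qed
qed

section \<open>The chain form and its norm\<close>

definition chain_coeff :: "nat \<Rightarrow> (nat \<Rightarrow> nat \<Rightarrow> real) \<Rightarrow> (nat \<Rightarrow> nat) \<Rightarrow> real" where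
  "chain_coeff m h i = (\<Prod>k\<in>{1..<m}. h (i (Suc k)) (i k))"

text \<open>The index is shifted by one: at \<open>m\<close> the first \<open>m + 1\<close> vectors
  have been used and \<open>h\<close> has been applied \<open>m\<close> times.\<close>

fun chain_vec ::
  "nat \<Rightarrow> (nat \<Rightarrow> nat \<Rightarrow> real) \<Rightarrow> (nat \<Rightarrow> nat \<Rightarrow> 'a::real_normed_field) \<Rightarrow> nat \<Rightarrow> nat \<Rightarrow> 'a" where
  "chain_vec n h x 0 = x 1"
| "chain_vec n h x (Suc m) =
     (\<lambda>j. x (Suc (Suc m)) j * (\<Sum>l=1..n. h j l *\<^sub>R chain_vec n h x m l))"

lemma sum_multi_indices_Suc:
  "(\<Sum>i\<in>multi_indices (Suc m) n. f i)
    = (\<Sum>j=1..n (Suc m). \<Sum>i\<in>multi_indices m n. f (i(Suc m := j)))"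
proof -
  have ins: "{1..Suc m} = insert (Suc m) {1..m}" by auto
  have "(\<Sum>i\<in>multi_indices (Suc m) n. f i)
      = (\<Sum>(j, i)\<in>{1..n (Suc m)} \<times> multi_indices m n. f (i(Suc m := j)))"
    unfolding multi_indices_def ins PiE_insert_eq
    by (subst sum.reindex[OF inj_combinator]) (auto intro: sum.cong)
  then show ?thesis by (simp add: sum.cartesian_product)
qed

text \<open>The test function \<open>g\<close> of the last index makes the induction go through.\<close>

lemma sum_chain_coeff:
  fixes x :: "nat \<Rightarrow> nat \<Rightarrow> 'a::real_normed_field"
  shows "(\<Sum>i\<in>multi_indices (Suc m) (\<lambda>_. n).
      of_real (chain_coeff (Suc m) h i) * (\<Prod>k=1..Suc m. x k (i k)) * g (i (Suc m)))
    = (\<Sum>j=1..n. chain_vec n h x m j * g j)"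
proof (induction m arbitrary: g)
  case 0
  then show ?case
    by (subst sum_multi_indices_Suc) (simp add: multi_indices_def chain_coeff_def)
next
  case (Suc m)
  have coeff: "chain_coeff (Suc (Suc m)) h (i(Suc (Suc m) := j))
      = chain_coeff (Suc m) h i * h j (i (Suc m))" for i j
    unfolding chain_coeff_def by (simp add: prod.atLeastLessThan_Suc)
  have prod: "(\<Prod>k=1..Suc (Suc m). x k ((i(Suc (Suc m) := j)) k))
      = (\<Prod>k=1..Suc m. x k (i k)) * x (Suc (Suc m)) j" for i j
    by (simp add: prod.nat_ivl_Suc')
  have "(\<Sum>i\<in>multi_indices (Suc (Suc m)) (\<lambda>_. n). of_real (chain_coeff (Suc (Suc m)) h i)
        * (\<Prod>k=1..Suc (Suc m). x k (i k)) * g (i (Suc (Suc m))))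
      = (\<Sum>j=1..n. x (Suc (Suc m)) j * g j * (\<Sum>i\<in>multi_indices (Suc m) (\<lambda>_. n).
          of_real (chain_coeff (Suc m) h i) * (\<Prod>k=1..Suc m. x k (i k)) * of_real (h j (i (Suc m)))))"
    by (subst sum_multi_indices_Suc)
      (simp only: coeff prod sum_distrib_left of_real_mult fun_upd_same mult_ac)
  \<comment> \<open>With row \<open>j\<close> of \<open>h\<close> as test function, the inner sum
    becomes coordinate \<open>j\<close> of \<open>h\<close> applied to the previous chain
    vector.\<close>
  also have "\<dots> = (\<Sum>j=1..n. chain_vec n h x (Suc m) j * g j)"
    unfolding Suc.IH[of "\<lambda>l. of_real (h _ l)"] by (simp add: scaleR_conv_of_real mult_ac)
  finally show ?case .
qed

lemma norm_le_linf_norm: "j \<in> {1..N} \<Longrightarrow> norm (v j) \<le> linf_norm N v"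
  unfolding linf_norm_def by (intro Max_ge) auto

text \<open>The first vector has squared Euclidean norm at most \<open>n\<close>. Each further step
  costs a factor \<open>c\<close> for \<open>h\<close> and nothing for the coordinatewise product
  with a vector from the unit ball.\<close>

lemma chain_vec_bound:
  fixes x :: "nat \<Rightarrow> nat \<Rightarrow> 'a::{real_normed_field, real_inner}"
  assumes h: "\<And>y :: nat \<Rightarrow> 'a.
      (\<Sum>i=1..n. (norm (\<Sum>j=1..n. h i j *\<^sub>R y j))\<^sup>2) \<le> c * (\<Sum>j=1..n. (norm (y j))\<^sup>2)"
    and "0 \<le> c"
    and x: "\<And>k j. k \<in> {1..Suc m} \<Longrightarrow> j \<in> {1..n} \<Longrightarrow> norm (x k j) \<le> 1"
  shows "(\<Sum>j=1..n. (norm (chain_vec n h x m j))\<^sup>2) \<le> c ^ m * n"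
  using x
proof (induction m)
  case 0
  have "(\<Sum>j=1..n. (norm (x 1 j))\<^sup>2) \<le> (\<Sum>j=1..n. 1)"
    using 0 by (intro sum_mono power_le_one) auto
  then show ?case by simp
next
  case (Suc m)
  have "(\<Sum>j=1..n. (norm (chain_vec n h x (Suc m) j))\<^sup>2)
      \<le> (\<Sum>j=1..n. (norm (\<Sum>l=1..n. h j l *\<^sub>R chain_vec n h x m l))\<^sup>2)"
    using Suc.prems by (intro sum_mono) (simp add: norm_mult power_mult_distrib mult_left_le_one_le power_le_one)
  also have "\<dots> \<le> c * (\<Sum>j=1..n. (norm (chain_vec n h x m j))\<^sup>2)" by (rule h)
  also have "\<dots> \<le> c * (c ^ m * n)"
    using Suc \<open>0 \<le> c\<close> by (intro mult_left_mono) auto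
  finally show ?case by (simp add: mult.assoc)
qed

lemma mform_chain_bound:
  fixes x :: "nat \<Rightarrow> nat \<Rightarrow> 'a::{real_normed_field, real_inner}"
  assumes h: "\<And>y :: nat \<Rightarrow> 'a.
      (\<Sum>i=1..n. (norm (\<Sum>j=1..n. h i j *\<^sub>R y j))\<^sup>2) \<le> c * (\<Sum>j=1..n. (norm (y j))\<^sup>2)"
    and "0 \<le> c"
    and x: "\<forall>k\<in>{1..Suc m}. linf_norm n (x k) \<le> 1"
  shows "norm (mform (Suc m) (\<lambda>_. n) (\<lambda>i. of_real (chain_coeff (Suc m) h i)) x) \<le> sqrt c ^ m * n"
proof -
  let ?v = "chain_vec n h x m"
  have "norm (x k j) \<le> 1" if "k \<in> {1..Suc m}" "j \<in> {1..n}" for k j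
    using norm_le_linf_norm[OF that(2), of "x k"] x that(1) by fastforce
  then have v: "(\<Sum>j=1..n. (norm (?v j))\<^sup>2) \<le> c ^ m * n"
    by (rule chain_vec_bound[OF h \<open>0 \<le> c\<close>])
  \<comment> \<open>The constant test function 1 recovers the form itself.\<close>
  have "mform (Suc m) (\<lambda>_. n) (\<lambda>i. of_real (chain_coeff (Suc m) h i)) x = (\<Sum>j=1..n. ?v j)"
    using sum_chain_coeff[where m = m and n = n and h = h and x = x and g = "\<lambda>_. 1"] by (simp add: mform_def)
  \<comment> \<open>Cauchy-Schwarz against the all-ones vector; the trivial factor brings the sum
    into the shape of \<open>L2_set_mult_ineq\<close>.\<close>
  also have "norm \<dots> \<le> (\<Sum>j=1..n. \<bar>1\<bar> * \<bar>norm (?v j)\<bar>)"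
    by (simp add: norm_sum)
  also have "\<dots> \<le> L2_set (\<lambda>_. 1) {1..n} * L2_set (\<lambda>j. norm (?v j)) {1..n}"
    by (rule L2_set_mult_ineq)
  also have "\<dots> \<le> sqrt n * sqrt (c ^ m * n)"
    unfolding L2_set_def using v by (intro mult_mono real_sqrt_le_mono) (auto intro: sum_nonneg)
  also have "\<dots> = sqrt c ^ m * n"
    by (simp add: real_sqrt_mult real_sqrt_power)
  finally show ?thesis .
qed

section \<open>Passage from the form to the constants\<close>

lemma KSZ_const_le:
  fixes K :: "'a::real_normed_field itself"
  assumes "1 \<le> m" "\<And>k. k \<in> {1..m} \<Longrightarrow> 1 \<le> n k" "admissible K m n C"
  shows "KSZ_const K m n \<le> C"
proof -
  obtain C0 where C0: "admissible K m n C0" "\<And>C'. admissible K m n C' \<Longrightarrow> C0 \<le> C'"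
    using admissible_least[of m n K] assms(1,2) by blast
  \<comment> \<open>The reals are not well-ordered, so \<open>LEAST\<close> is controlled through
    the attained minimum \<open>C0\<close>.\<close>
  then have "KSZ_const K m n = C0" unfolding KSZ_const_def by (rule Least_equality)
  then show ?thesis using C0(2) assms(3) by simp
qed

text \<open>With \<open>c = 8 / 5 * n\<close> the norm is at most \<open>sqrt (8 / 5) ^ m\<close>
  times \<open>n\<close> to the power \<open>m / 2 + 1\<close>. For \<open>Suc m\<close> equal
  dimensions the normalisation is exactly that power of \<open>n\<close>, so the dimension
  cancels.\<close>

lemma admissible_chain:
  fixes K :: "'a::{real_normed_field, real_inner} itself"
  assumes "1 \<le> n"
  shows "admissible K (Suc m) (\<lambda>_. n) (sqrt (8 / 5) ^ m)"
proof -
  obtain h :: "nat \<Rightarrow> nat \<Rightarrow> real"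
    where sign: "\<And>i j. i \<in> {1..n} \<Longrightarrow> j \<in> {1..n} \<Longrightarrow> h i j \<in> {-1, 1}"
      and h: "\<And>x :: nat \<Rightarrow> 'a. (\<Sum>i=1..n. (norm (\<Sum>j=1..n. h i j *\<^sub>R x j))\<^sup>2)
        \<le> 8 / 5 * n * (\<Sum>j=1..n. (norm (x j))\<^sup>2)"
    using exists_sign_matrix[OF assms, where 'a = 'a] by blast
  let ?a = "\<lambda>i. of_real (chain_coeff (Suc m) h i) :: 'a"
  have "?a i \<in> {-1, 1}" if "i \<in> multi_indices (Suc m) (\<lambda>_. n)" for i
  proof -
    have "i k \<in> {1..n}" if "k \<in> {1..Suc m}" for k
      using PiE_mem[OF \<open>i \<in> _\<close>[unfolded multi_indices_def] that] .
    then have "\<bar>h (i (Suc k)) (i k)\<bar> = 1" if "k \<in> {1..<Suc m}" for k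
      using sign[of "i (Suc k)" "i k"] that by auto
    then have "\<bar>chain_coeff (Suc m) h i\<bar> = 1"
      unfolding chain_coeff_def abs_prod by (intro prod.neutral) blast
    then have "chain_coeff (Suc m) h i = -1 \<or> chain_coeff (Suc m) h i = 1" by arith
    then show ?thesis by auto
  qed
  moreover have "mform_norm (Suc m) (\<lambda>_. n) ?a \<le> sqrt (8 / 5 * n) ^ m * n"
    unfolding mform_norm_def
  proof (rule cSUP_least)
    \<comment> \<open>The zero tuple is a witness; \<open>1 \<le> n\<close> ensures that the
      \<open>Max\<close> in \<open>linf_norm\<close> is over a nonempty set.\<close>
    show "{x :: nat \<Rightarrow> nat \<Rightarrow> 'a. \<forall>k\<in>{1..Suc m}. linf_norm n (x k) \<le> 1} \<noteq> {}"
      using assms by (auto simp: linf_norm_def intro!: exI[of _ "\<lambda>_ _. 0"])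
  next
    fix x :: "nat \<Rightarrow> nat \<Rightarrow> 'a"
    assume "x \<in> {x. \<forall>k\<in>{1..Suc m}. linf_norm n (x k) \<le> 1}"
    then show "norm (mform (Suc m) (\<lambda>_. n) ?a x) \<le> sqrt (8 / 5 * n) ^ m * n"
      by (intro mform_chain_bound[OF h]) auto
  qed
  moreover have "(\<lambda>k. sqrt (real n)) ` {1..Suc m} = {sqrt (real n)}" by auto
  then have "sqrt (8 / 5) ^ m * Max ((\<lambda>k. sqrt (real n)) ` {1..Suc m}) * (\<Prod>k=1..Suc m. sqrt (real n))
      = sqrt (8 / 5 * n) ^ m * n"
    unfolding real_sqrt_mult[of "8 / 5" "real n"] by (simp add: power_mult_distrib)
  ultimately show ?thesis unfolding admissible_def by (intro conjI exI[of _ ?a]) auto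
qed

text \<open>The two sort constraints cover both \<open>real\<close> and \<open>complex\<close>, so
  one argument serves both fields.\<close>

lemma KSZ_sup_le:
  fixes K :: "'a::{real_normed_field, real_inner} itself"
  assumes "1 \<le> m"
  shows "KSZ_sup K m \<le> ereal ((8 / 5) powr ((real m - 1) / 2))"
proof -
  obtain l where m: "m = Suc l" using assms by (cases m) auto
  have "(8 / 5) powr ((real m - 1) / 2) = ((8 / 5) powr (1 / 2)) powr real l"
    unfolding powr_powr by (simp add: m)
  also have "\<dots> = sqrt (8 / 5) ^ l"
    by (simp add: powr_half_sqrt powr_realpow)
  finally show ?thesis
    unfolding KSZ_sup_def using KSZ_const_le[OF assms _ admissible_chain[of _ K l, folded m]]
    by (auto intro!: SUP_least)
qed

theorem theorem4p6:
  fixes m :: nat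
  assumes "1 \<le> m"
  shows "KSZ_sup TYPE(real) m \<le> ereal ((8 / 5) powr ((real m - 1) / 2)) \<and>
         KSZ_sup TYPE(complex) m \<le> ereal ((8 / 5) powr ((real m - 1) / 2))"
  using assms by (intro conjI KSZ_sup_le)

end
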